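(* For every positive integer $k\in\mathbb{N}$, the sentence $\varphi_k$ holds in $PA^-$, i.e. $\varphi_k$ is true in every model of $PA^-$ (equivalently, it is provable from the axioms of $PA^-$), where $\varphi_k$ is the following first-order sentence: $$(\forall n)(\forall m_0)\ldots(\forall m_k)(\forall p)\ \Big[\ \bigvee_{i=0}^k \big((\forall a)(\forall b)\ m_i a\neq (n+\overline{i})b+1\big)\ \vee\ \bigvee_{i=0}^k\ n+\overline{i}<m_i\ \vee\ \sum_{i=0}^k\Big(m_i\prod_{0\le j\le k,\ j\neq i}(n+\overline{j})\Big)\neq p\prod_{j=0}^k(n+\overline{j})\ \Big].$$
   Context: $PA^-$ is the first-order theory with equality in the language with binary operations $+,\cdot$, constants $0,1$ and binary relation $<$ (with $x>y$ meaning $y<x$), axiomatized by the universal closures of: A1 $(x+y)+z=x+(y+z)$; A2 $x+y=y+x$; A3 $(x\cdot y)\cdot z=x\cdot(y\cdot z)$; A4 $x\cdot y=y\cdot x$; A5 $x\cdot(y+z)=x\cdot y+x\cdot z$; A6 $x+0=x\wedge x\cdot 0=0$; A7 $x\cdot 1=x$; A8 $(x<y\wedge y<z)\rightarrow x<z$; A9 $\neg\, x<x$; A10 $x<y\vee x=y\vee y<x$; A11 $x<y\rightarrow x+z<y+z$; A12 $(0<z\wedge x<y)\rightarrow x\cdot z<y\cdot z$; A13 $(\forall x)(\forall y)(\exists z)\ (x<y\rightarrow x+z=y)$; A14 $0<1\wedge(x>0\rightarrow(x>1\vee x=1))$; A15 $x>0\vee x=0$. There is no induction axiom. For $u\in\mathbb{N}$,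 the numeral $\overline{u}$ is the term $((\ldots((1+1)+1)+\ldots)+1)$ with $u$ occurrences of $1$ (and $\overline{0}$ is $0$). The integer $k$ is an external (standard) positive integer, so the disjunctions, sums and products indexed by $0,\dots,k$ are finite expressions of the language; all quantified variables range over the universe of the model. *)

theory Defs
  imports Main
begin

section \<open>First-order logic over the language of ordered semirings\<close>

datatype tm =
    Var nat
  | Zero  ("\<^bold>0")
  | One  ("\<^bold>1")
  | Plus tm tm  (infixl "\<^bold>+" 65)
  | Times tm tm  (infixl "\<^bold>*" 70)

datatype fm =
    Eq tm tm  (infix "\<^bold>=" 50)
  | Less tm tm  (infix "\<^bold><" 50)
  | Neg fm  ("\<^bold>\<not> _" [40] 40)
  | And fm fm  (infixr "\<^bold>\<and>" 35)
  | Or fm fm  (infixr "\<^bold>\<or>" 30)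
  | Imp fm fm  (infixr "\<^bold>\<longrightarrow>" 25)
  | All nat fm
  | Ex nat fm

abbreviation Neq :: "tm \<Rightarrow> tm \<Rightarrow> fm"  (infix "\<^bold>\<noteq>" 50) where
  "s \<^bold>\<noteq> t \<equiv> \<^bold>\<not> (s \<^bold>= t)"

definition Alls :: "nat list \<Rightarrow> fm \<Rightarrow> fm" where
  "Alls xs \<phi> = foldr All xs \<phi>"

text \<open>The universe of a structure is the (nonempty) type \<open>'a\<close>; equality is interpreted as
  true equality.\<close>

record 'a lstruct =
  s_plus :: "'a \<Rightarrow> 'a \<Rightarrow> 'a"
  s_times :: "'a \<Rightarrow> 'a \<Rightarrow> 'a"
  s_zero :: 'a
  s_one :: 'a
  s_less :: "'a \<Rightarrow> 'a \<Rightarrow> bool"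

primrec eval_tm :: "'a lstruct \<Rightarrow> (nat \<Rightarrow> 'a) \<Rightarrow> tm \<Rightarrow> 'a" where
  "eval_tm M e (Var x) = e x"
| "eval_tm M e \<^bold>0 = s_zero M"
| "eval_tm M e \<^bold>1 = s_one M"
| "eval_tm M e (s \<^bold>+ t) = s_plus M (eval_tm M e s) (eval_tm M e t)"
| "eval_tm M e (s \<^bold>* t) = s_times M (eval_tm M e s) (eval_tm M e t)"

primrec sat :: "'a lstruct \<Rightarrow> (nat \<Rightarrow> 'a) \<Rightarrow> fm \<Rightarrow> bool" where
  "sat M e (s \<^bold>= t) \<longleftrightarrow> eval_tm M e s = eval_tm M e t"
| "sat M e (s \<^bold>< t) \<longleftrightarrow> s_less M (eval_tm M e s) (eval_tm M e t)"
| "sat M e (\<^bold>\<not> \<phi>) \<longleftrightarrow> \<not> sat M e \<phi>"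
| "sat M e (\<phi> \<^bold>\<and> \<psi>) \<longleftrightarrow> sat M e \<phi> \<and> sat M e \<psi>"
| "sat M e (\<phi> \<^bold>\<or> \<psi>) \<longleftrightarrow> sat M e \<phi> \<or> sat M e \<psi>"
| "sat M e (\<phi> \<^bold>\<longrightarrow> \<psi>) \<longleftrightarrow> (sat M e \<phi> \<longrightarrow> sat M e \<psi>)"
| "sat M e (All x \<phi>) \<longleftrightarrow> (\<forall>v. sat M (e(x := v)) \<phi>)"
| "sat M e (Ex x \<phi>) \<longleftrightarrow> (\<exists>v. sat M (e(x := v)) \<phi>)"

definition holds_in :: "'a lstruct \<Rightarrow> fm \<Rightarrow> bool" where
  "holds_in M \<phi> \<longleftrightarrow> (\<forall>e. sat M e \<phi>)"

definition is_model :: "'a lstruct \<Rightarrow> fm set \<Rightarrow> bool" where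
  "is_model M T \<longleftrightarrow> (\<forall>\<phi>\<in>T. holds_in M \<phi>)"


section \<open>The theory \<open>PA\<^sup>-\<close>\<close>

definition PA_minus :: "fm set" where
  "PA_minus = (let x = 0; y = 1; z = 2; X = Var x; Y = Var y; Z = Var z in
    { Alls [x, y, z] ((X \<^bold>+ Y) \<^bold>+ Z \<^bold>= X \<^bold>+ (Y \<^bold>+ Z)),
      Alls [x, y] (X \<^bold>+ Y \<^bold>= Y \<^bold>+ X),
      Alls [x, y, z] ((X \<^bold>* Y) \<^bold>* Z \<^bold>= X \<^bold>* (Y \<^bold>* Z)),
      Alls [x, y] (X \<^bold>* Y \<^bold>= Y \<^bold>* X),
      Alls [x, y, z] (X \<^bold>* (Y \<^bold>+ Z) \<^bold>= X \<^bold>* Y \<^bold>+ X \<^bold>* Z),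
      Alls [x] (X \<^bold>+ \<^bold>0 \<^bold>= X \<^bold>\<and> X \<^bold>* \<^bold>0 \<^bold>= \<^bold>0),
      Alls [x] (X \<^bold>* \<^bold>1 \<^bold>= X),
      Alls [x, y, z] ((X \<^bold>< Y \<^bold>\<and> Y \<^bold>< Z) \<^bold>\<longrightarrow> X \<^bold>< Z),
      Alls [x] (\<^bold>\<not> (X \<^bold>< X)),
      Alls [x, y] (X \<^bold>< Y \<^bold>\<or> X \<^bold>= Y \<^bold>\<or> Y \<^bold>< X),
      Alls [x, y, z] (X \<^bold>< Y \<^bold>\<longrightarrow> X \<^bold>+ Z \<^bold>< Y \<^bold>+ Z),
      Alls [x, y, z] ((\<^bold>0 \<^bold>< Z \<^bold>\<and> X \<^bold>< Y) \<^bold>\<longrightarrow> X \<^bold>* Z \<^bold>< Y \<^bold>* Z),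
      Alls [x, y] (Ex z (X \<^bold>< Y \<^bold>\<longrightarrow> X \<^bold>+ Z \<^bold>= Y)),
      Alls [x] (\<^bold>0 \<^bold>< \<^bold>1 \<^bold>\<and> (\<^bold>0 \<^bold>< X \<^bold>\<longrightarrow> (\<^bold>1 \<^bold>< X \<^bold>\<or> X \<^bold>= \<^bold>1))),
      Alls [x] (\<^bold>0 \<^bold>< X \<^bold>\<or> X \<^bold>= \<^bold>0) })"


section \<open>The sentences \<open>\<phi>\<^sub>k\<close>\<close>

fun num_tm :: "nat \<Rightarrow> tm" where
  "num_tm 0 = \<^bold>0"
| "num_tm (Suc 0) = \<^bold>1"
| "num_tm (Suc (Suc u)) = num_tm (Suc u) \<^bold>+ \<^bold>1"

text \<open>Finite disjunctions, sums and products as expressions of the language, bracketed to the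
  left. The index list is nonempty in every use below (for the products this needs \<open>k \<ge> 1\<close>).\<close>

definition big :: "('b \<Rightarrow> 'b \<Rightarrow> 'b) \<Rightarrow> nat list \<Rightarrow> (nat \<Rightarrow> 'b) \<Rightarrow> 'b" where
  "big c is f = foldl c (f (hd is)) (map f (tl is))"

definition phi :: "nat \<Rightarrow> fm" where
  "phi k = (let n = 0; p = 1; a = 2; b = 3; m = (\<lambda>i. 4 + i); I = [0..<Suc k];
               N = (\<lambda>i. Var n \<^bold>+ num_tm i) in
    Alls ([n] @ map m I @ [p])
      (big Or I (\<lambda>i. Alls [a, b] (Var (m i) \<^bold>* Var a \<^bold>\<noteq> N i \<^bold>* Var b \<^bold>+ \<^bold>1)) \<^bold>\<or>
       big Or I (\<lambda>i. N i \<^bold>< Var (m i)) \<^bold>\<or>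
       big Plus I (\<lambda>i. Var (m i) \<^bold>* big Times (filter (\<lambda>j. j \<noteq> i) I) N)
         \<^bold>\<noteq> Var p \<^bold>* big Times I N))"

end

theory Submission imports Defs "HOL-Computational_Algebra.Primes"
begin

text \<open>Suppose all three disjuncts fail. Modulo \<open>n\<close>, the right-hand side of the equation
  and all summands but \<open>m\<^sub>0 (n + 1) \<dots> (n + k)\<close> vanish, and since \<open>m\<^sub>0\<close> is invertible modulo
  \<open>n\<close> this leaves \<open>n dvd k!\<close>.
  So \<open>n\<close> is bounded by a numeral, hence is itself a numeral, and then so are the \<open>m\<^sub>i \<le> n + i\<close>
  and \<open>p\<close>. What remains is a statement on natural numbers: exactly one \<open>n + i\<close> has maximal
  2-adic valuation, its \<open>m\<^sub>i\<close> is odd, so \<open>\<Sum> m\<^sub>i / (n + i)\<close> has negative 2-adic valuation.\<close>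

section \<open>2-adic valuations of consecutive natural numbers\<close>

text \<open>Two numbers sharing the maximal valuation \<open>v\<close> would both be odd multiples
  of \<open>2 ^ v\<close>; the even multiple right after the smaller one would lie in the range and
  have a larger valuation.\<close>

lemma multiplicity_2_less_of_maximal:
  fixes n k :: nat
  assumes "n > 0" "i \<le> k" "j \<le> k" "i \<noteq> j"
    and max: "\<And>l. l \<le> k \<Longrightarrow> multiplicity 2 (n + l) \<le> multiplicity 2 (n + i)"
  shows "multiplicity 2 (n + j) < multiplicity 2 (n + i)"
proof (rule ccontr)
  define v where "v = multiplicity 2 (n + i)"
  assume "\<not> ?thesis"
  then have vj: "multiplicity 2 (n + j) = v"
    using max[OF assms(3)] unfolding v_def by linarith
  have unit: "\<not> is_unit (2::nat)" by simp
  have no: "\<not> 2 ^ Suc v dvd n + l" if "l \<le> k" for l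
    using max[OF that] \<open>n > 0\<close> unfolding v_def
    by (subst power_dvd_iff_le_multiplicity) auto
  have gap: False if ab: "a < b" "b \<le> k" and da: "2 ^ v dvd n + a" and db: "2 ^ v dvd n + b" for a b
  proof -
    obtain q where q: "n + a = 2 ^ v * q" using da by (rule dvdE)
    have "odd q"
    proof
      assume "even q"
      then have "2 ^ Suc v dvd n + a" unfolding q by (auto elim!: dvdE)
      then show False using no[of a] ab by simp
    qed
    obtain r where r: "n + b = 2 ^ v * r" using db by (rule dvdE)
    have "2 ^ v * q < 2 ^ v * r" using ab(1) q[symmetric] r[symmetric] by simp
    then have "q < r" by simp
    \<comment> \<open>The next multiple of \<open>2 ^ v\<close> after \<open>n + a\<close> is at
      most \<open>n + b\<close>, so its index \<open>a + 2 ^ v\<close> stays within \<open>k\<close>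
      and \<open>no\<close> applies to it.\<close>
    then have "2 ^ v * Suc q \<le> 2 ^ v * r" by (intro mult_le_mono2) simp
    then have "n + (a + 2 ^ v) \<le> n + b" using q r by simp
    then have "a + 2 ^ v \<le> k" using ab by simp
    have "2 ^ v * 2 dvd 2 ^ v * (q + 1)"
      using \<open>odd q\<close> by (intro mult_dvd_mono) auto
    moreover have "2 ^ v * (q + 1) = n + (a + 2 ^ v)" using q by simp
    ultimately have "2 ^ Suc v dvd n + (a + 2 ^ v)" by (simp only: power_Suc2)
    then show False using no[OF \<open>a + 2 ^ v \<le> k\<close>] by contradiction
  qed
  have "2 ^ v dvd n + i" unfolding v_def by (rule multiplicity_dvd)
  moreover have "2 ^ v dvd n + j" unfolding vj[symmetric] by (rule multiplicity_dvd)
  ultimately show False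
    using gap[of i j] gap[of j i] assms by (cases i j rule: linorder_cases) auto
qed

text \<open>Division-free valuation argument: with \<open>t\<close> the valuation of the cofactor
  \<open>A\<close> at the maximal index \<open>i\<close>, \<open>2 ^ Suc t\<close> divides the
  right-hand side and every summand except the \<open>i\<close>-th.\<close>

lemma sum_cofactors_ne_multiple:
  fixes n k p :: nat and m :: "nat \<Rightarrow> nat"
  assumes "k > 0" "n > 0" and odd: "\<And>i. i \<le> k \<Longrightarrow> even (n + i) \<Longrightarrow> odd (m i)"
  shows "(\<Sum>i\<le>k. m i * (\<Prod>j\<in>{..k} - {i}. n + j)) \<noteq> p * (\<Prod>j\<le>k. n + j)"
proof
  assume eq: "(\<Sum>i\<le>k. m i * (\<Prod>j\<in>{..k} - {i}. n + j)) = p * (\<Prod>j\<le>k. n + j)"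
  define v where "v j = multiplicity 2 (n + j)" for j
  have two: "prime_elem (2::nat)" by simp
  have "\<exists>i\<in>{..k}. \<forall>l\<in>{..k}. v l \<le> v i"
    using Max_in[of "v ` {..k}"] Max_ge[of "v ` {..k}"] by fastforce
  then obtain i where i: "i \<le> k" and max: "\<And>l. l \<le> k \<Longrightarrow> v l \<le> v i" by auto
  have less: "v j < v i" if "j \<le> k" "j \<noteq> i" for j
    using multiplicity_2_less_of_maximal[of n i k j] that i max assms(2) unfolding v_def by auto
  \<comment> \<open>As \<open>k > 0\<close>, there is a second index, of strictly smaller valuation;
    hence \<open>n + i\<close> is even and the parity hypothesis reaches \<open>m i\<close>.\<close>
  have "\<exists>j\<le>k. j \<noteq> i" using assms(1) by (intro exI[of _ "if i = 0 then 1 else 0"]) auto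
  then have "v i > 0" using less by fastforce
  then have ev: "even (n + i)" unfolding v_def
    using not_dvd_imp_multiplicity_0[of 2 "n + i"] by auto
  define A where "A = (\<Prod>j\<in>{..k} - {i}. n + j)"
  define t where "t = multiplicity 2 A"
  have "A \<noteq> 0" unfolding A_def using assms by simp
  have top: "\<not> 2 ^ Suc t dvd m i * A"
  proof -
    have "m i \<noteq> 0" using odd[OF i ev] by (intro notI) simp
    have "multiplicity 2 (m i * A) = t"
      using two \<open>m i \<noteq> 0\<close> \<open>A \<noteq> 0\<close> odd[OF i ev] unfolding t_def
      by (simp add: prime_elem_multiplicity_mult_distrib not_dvd_imp_multiplicity_0)
    then show ?thesis using \<open>m i \<noteq> 0\<close> \<open>A \<noteq> 0\<close>
      by (subst power_dvd_iff_le_multiplicity) auto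
  qed
  have rest: "2 ^ Suc t dvd m l * (\<Prod>j\<in>{..k} - {l}. n + j)" if l: "l \<in> {..k} - {i}" for l
  proof -
    \<comment> \<open>\<open>B\<close> omits both indices: the cofactor of \<open>i\<close> is
      \<open>(n + l) * B\<close>, that of \<open>l\<close> is \<open>(n + i) * B\<close>, and
      \<open>v l < v i\<close> gives the latter the larger valuation.\<close>
    define B where "B = (\<Prod>j\<in>{..k} - {l} - {i}. n + j)"
    have "B \<noteq> 0" unfolding B_def using assms by simp
    have 1: "(\<Prod>j\<in>{..k} - {l}. n + j) = (n + i) * B"
      unfolding B_def using l i by (intro prod.remove) auto
    have "A = (n + l) * (\<Prod>j\<in>{..k} - {i} - {l}. n + j)"
      unfolding A_def using l by (intro prod.remove) auto
    also have "{..k} - {i} - {l} = {..k} - {l} - {i}" by auto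
    finally have "A = (n + l) * B" unfolding B_def .
    then have "t = v l + multiplicity 2 B"
      unfolding t_def v_def using two \<open>B \<noteq> 0\<close> assms(2)
      by (simp add: prime_elem_multiplicity_mult_distrib)
    then have "Suc t \<le> multiplicity 2 ((n + i) * B)"
      using less[of l] l two \<open>B \<noteq> 0\<close> assms(2)
      by (simp add: prime_elem_multiplicity_mult_distrib v_def)
    then have "2 ^ Suc t dvd (n + i) * B" by (rule multiplicity_dvd')
    then show ?thesis unfolding 1 by (rule dvd_mult)
  qed
  have "(\<Prod>j\<le>k. n + j) = (n + i) * A"
    unfolding A_def using i by (intro prod.remove) auto
  moreover have "2 * 2 ^ t dvd (n + i) * A"
    using ev unfolding t_def by (intro mult_dvd_mono multiplicity_dvd)
  ultimately have "2 ^ Suc t dvd p * (\<Prod>j\<le>k. n + j)" by simp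
  then have "2 ^ Suc t dvd
      m i * A + (\<Sum>l\<in>{..k} - {i}. m l * (\<Prod>j\<in>{..k} - {l}. n + j))"
    unfolding eq[symmetric] A_def using i by (subst (asm) sum.remove[of _ i]) auto
  moreover have "2 ^ Suc t dvd (\<Sum>l\<in>{..k} - {i}. m l * (\<Prod>j\<in>{..k} - {l}. n + j))"
    using rest by (rule dvd_sum)
  ultimately show False using top by (simp only: dvd_add_left_iff)
qed

section \<open>Discretely ordered semirings\<close>

text \<open>Algebraic counterpart of \<open>PA_minus\<close>: the canonical order encodes
  nonnegativity and subtraction of smaller from larger elements, and \<open>one_le\<close> is
  discreteness.\<close>

class discrete_semiring = linordered_nonzero_semiring + canonically_ordered_monoid_add
  + cancel_semigroup_add +
  assumes one_le: "0 < a \<Longrightarrow> 1 \<le> a"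
begin

lemma of_nat_prod_eq: "of_nat (prod f A) = (\<Prod>x\<in>A. of_nat (f x))"
  by (induct A rule: infinite_finite_induct) simp_all

lemma of_nat_sum_eq: "of_nat (sum f A) = (\<Sum>x\<in>A. of_nat (f x))"
  by (induct A rule: infinite_finite_induct) simp_all

text \<open>By discreteness a nonzero \<open>x\<close> is \<open>1 + y\<close>, and cancelling 1
  from the bound \<open>Suc u\<close> leaves \<open>y\<close> at most \<open>u\<close>; so no
  nonstandard element lies below a numeral.\<close>

lemma le_of_nat_imp_of_nat:
  assumes "x \<le> of_nat u"
  shows "\<exists>w. x = of_nat w"
  using assms
proof (induct u arbitrary: x)
  case 0
  then have "x = of_nat 0" by simp
  then show ?case ..
next
  case (Suc u)
  show ?case
  proof (cases "x = 0")
    case True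
    then have "x = of_nat 0" by simp
    then show ?thesis ..
  next
    case False
    then have "1 \<le> x" by (intro one_le) (simp add: zero_less_iff_neq_zero)
    then obtain y where y: "x = 1 + y" using le_iff_add by auto
    obtain c where "of_nat (Suc u) = x + c" using Suc.prems le_iff_add by auto
    then have "1 + of_nat u = 1 + (y + c)" using y by (simp add: add.assoc)
    then have "of_nat u = y + c" by (rule add_left_imp_eq)
    then have "y \<le> of_nat u" using le_iff_add by auto
    then obtain w where "y = of_nat w" using Suc.hyps by blast
    then have "x = of_nat (Suc w)" using y by simp
    then show ?thesis ..
  qed
qed

lemma le_mult_pos:
  assumes "0 < w"
  shows "x \<le> x * w"
  using mult_left_mono[OF one_le[OF assms], of x] by simp

text \<open>Expanded in powers of \<open>x\<close>, the product has constant term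
  \<open>fact k\<close>; \<open>t\<close> collects the rest.\<close>

lemma prod_add_of_nat_eq_fact: "\<exists>t. (\<Prod>j\<in>{..k} - {0}. x + of_nat j) = of_nat (fact k) + x * t"
proof (induct k)
  case 0
  show ?case by (intro exI[of _ 0]) simp
next
  case (Suc k)
  then obtain t where t: "(\<Prod>j\<in>{..k} - {0}. x + of_nat j) = of_nat (fact k) + x * t" by blast
  have "{..Suc k} - {0} = insert (Suc k) ({..k} - {0})" by auto
  then have "(\<Prod>j\<in>{..Suc k} - {0}. x + of_nat j)
      = (x + of_nat (Suc k)) * (of_nat (fact k) + x * t)"
    using t by simp
  also have "\<dots> = of_nat (Suc k) * of_nat (fact k)
      + x * (of_nat (fact k) + x * t + of_nat (Suc k) * t)"
    by (simp only: distrib_left distrib_right ac_simps)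
  also have "of_nat (Suc k) * of_nat (fact k) = of_nat (fact (Suc k))"
    by (simp only: of_nat_mult[symmetric]) simp
  finally show ?case ..
qed

text \<open>Differences exist only when nonnegative, so \<open>u\<close> and \<open>v\<close> are
  compared: either \<open>v\<close> minus \<open>u\<close> is the quotient, or \<open>c\<close> is
  forced to be 0.\<close>

lemma dvd_of_add_mult_eq_mult:
  assumes "0 < x" "c + x * u = x * v"
  shows "x dvd c"
proof (cases "u \<le> v")
  case True
  then obtain w where "v = u + w" using le_iff_add by auto
  then have "x * u + c = x * u + x * w" using assms by (simp add: distrib_left add.commute)
  then have "c = x * w" by (rule add_left_imp_eq)
  then show ?thesis by simp
next
  case False
  then have "x * v \<le> x * u" by (intro mult_left_mono) auto
  then obtain d where "x * u = x * v + d" using le_iff_add by auto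
  then have "x * v + (d + c) = x * v + 0" using assms by (simp add: ac_simps)
  then have "d + c = 0" by (rule add_left_imp_eq)
  then show ?thesis by simp
qed

theorem sum_cofactors_ne_multiple_discrete:
  assumes "k > 0"
    and unit: "\<And>i. i \<le> k \<Longrightarrow> \<exists>a b. m i * a = (x + of_nat i) * b + 1"
    and le: "\<And>i. i \<le> k \<Longrightarrow> m i \<le> x + of_nat i"
  shows "(\<Sum>i\<le>k. m i * (\<Prod>j\<in>{..k} - {i}. x + of_nat j)) \<noteq> p * (\<Prod>j\<le>k. x + of_nat j)"
proof
  assume eq: "(\<Sum>i\<le>k. m i * (\<Prod>j\<in>{..k} - {i}. x + of_nat j)) = p * (\<Prod>j\<le>k. x + of_nat j)"
  obtain a b where ab: "m 0 * a = x * b + 1" using unit[of 0] by auto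
  \<comment> \<open>For \<open>x = 0\<close> the bound gives \<open>m 0 = 0\<close>, and
    \<open>ab\<close> becomes \<open>0 = 1\<close>.\<close>
  have "x \<noteq> 0" using le[of 0] ab by (intro notI) simp
  then have "0 < x" by (simp add: zero_less_iff_neq_zero)
  obtain t where t: "(\<Prod>j\<in>{..k} - {0}. x + of_nat j) = of_nat (fact k) + x * t"
    using prod_add_of_nat_eq_fact by blast
  have split: "(\<Prod>j\<in>A. x + of_nat j) = x * (\<Prod>j\<in>A - {0}. x + of_nat j)" if "finite A" "0 \<in> A" for A
    using prod.remove[OF that, of "\<lambda>j. x + of_nat j"] by simp
  \<comment> \<open>Every cofactor with \<open>i \<noteq> 0\<close> still contains the factor at
    \<open>j = 0\<close>, which is \<open>x\<close>.\<close>
  have "x dvd (\<Sum>i\<in>{..k} - {0}. m i * (\<Prod>j\<in>{..k} - {i}. x + of_nat j))"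
    by (intro dvd_sum dvd_mult) (subst split, auto)
  then obtain r where r: "(\<Sum>i\<in>{..k} - {0}. m i * (\<Prod>j\<in>{..k} - {i}. x + of_nat j)) = x * r"
    by (rule dvdE)
  define c where "c = (of_nat (fact k) :: 'a)"
  have "(\<Sum>i\<le>k. m i * (\<Prod>j\<in>{..k} - {i}. x + of_nat j)) = m 0 * (c + x * t) + x * r"
    using r t sum.remove[of "{..k}" 0 "\<lambda>i. m i * (\<Prod>j\<in>{..k} - {i}. x + of_nat j)"]
    unfolding c_def by simp
  moreover have "p * (\<Prod>j\<le>k. x + of_nat j) = x * (p * (c + x * t))"
    using t unfolding c_def by (subst split) (auto simp: ac_simps)
  \<comment> \<open>Multiplying by \<open>a\<close> turns \<open>m 0\<close> into
    \<open>x * b + 1\<close>, so that modulo \<open>x\<close> only \<open>c\<close>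
    survives.\<close>
  ultimately have "a * (m 0 * (c + x * t) + x * r) = a * (x * (p * (c + x * t)))"
    using eq by simp
  moreover have "a * (m 0 * (c + x * t) + x * r) = (m 0 * a) * (c + x * t) + x * (a * r)"
    by (simp only: distrib_left distrib_right ac_simps)
  moreover have "(x * b + 1) * (c + x * t) + x * (a * r) = c + x * (b * (c + x * t) + t + a * r)"
    by (simp only: distrib_left distrib_right ac_simps mult_1_left mult_1_right)
  ultimately have "c + x * (b * (c + x * t) + t + a * r) = x * (a * (p * (c + x * t)))"
    using ab by (simp add: mult.left_commute)
  then have "x dvd c" by (rule dvd_of_add_mult_eq_mult[OF \<open>0 < x\<close>])
  then obtain w where w: "c = x * w" by (rule dvdE)
  \<comment> \<open>The quotient is nonzero because \<open>fact k\<close> is, so \<open>x\<close> is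
    at most \<open>fact k\<close> and hence standard.\<close>
  have "w \<noteq> 0" using w unfolding c_def by (intro notI) simp
  then have "0 < w" by (simp add: zero_less_iff_neq_zero)
  then have "x \<le> of_nat (fact k)" using le_mult_pos[of w x] w unfolding c_def by simp
  then obtain n where n: "x = of_nat n" using le_of_nat_imp_of_nat by blast
  have "n > 0" using \<open>0 < x\<close> n by simp
  have "\<exists>u. m i = of_nat u" if "i \<le> k" for i
    using le[OF that] unfolding n of_nat_add[symmetric] by (rule le_of_nat_imp_of_nat)
  then obtain m' where m': "\<And>i. i \<le> k \<Longrightarrow> m i = of_nat (m' i)" by metis
  have P: "(\<Prod>j\<in>A. x + of_nat j) = of_nat (\<Prod>j\<in>A. n + j)" for A
    unfolding n by (simp add: of_nat_prod_eq)
  have S: "p * of_nat (\<Prod>j\<le>k. n + j) = of_nat (\<Sum>i\<le>k. m' i * (\<Prod>j\<in>{..k} - {i}. n + j))"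
    unfolding eq[symmetric, unfolded P] of_nat_sum_eq using m' by (intro sum.cong) auto
  have "0 < (\<Prod>j\<le>k. n + j)" using \<open>n > 0\<close> by simp
  then have "0 < (of_nat (\<Prod>j\<le>k. n + j) :: 'a)" by (simp only: of_nat_0_less_iff)
  \<comment> \<open>A positive factor does not decrease \<open>p\<close>, and by \<open>S\<close>
    the product is standard; hence so is \<open>p\<close>.\<close>
  from le_mult_pos[OF this, of p] obtain p' where p: "p = of_nat p'"
    unfolding S using le_of_nat_imp_of_nat by blast
  have "(\<Sum>i\<le>k. m' i * (\<Prod>j\<in>{..k} - {i}. n + j)) = p' * (\<Prod>j\<le>k. n + j)"
    using S unfolding p of_nat_mult[symmetric] by (simp only: of_nat_eq_iff)
  \<comment> \<open>The witnesses \<open>a\<close> and \<open>b\<close> may be nonstandard, so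
    parity is argued inside the semiring: a common factor 2 of \<open>m i\<close> and
    \<open>x + of_nat i\<close> would divide 1.\<close>
  moreover have "odd (m' i)" if i: "i \<le> k" and ev: "even (n + i)" for i
  proof
    assume "even (m' i)"
    then obtain u where u: "m' i = 2 * u" by (rule evenE)
    obtain s where s: "n + i = 2 * s" using ev by (rule evenE)
    obtain a b where ab: "m i * a = (x + of_nat i) * b + 1" using unit[OF i] by auto
    have xi: "x + of_nat i = of_nat 2 * of_nat s"
      unfolding n of_nat_add[symmetric] s of_nat_mult ..
    have mi: "m i = of_nat 2 * of_nat u"
      unfolding m'[OF i] u of_nat_mult ..
    have "1 + of_nat 2 * (of_nat s * b) = of_nat 2 * (of_nat u * a)"
      using ab[symmetric] unfolding xi mi mult.assoc by (subst add.commute)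
    then have "of_nat 2 dvd 1" by (rule dvd_of_add_mult_eq_mult[rotated]) simp
    then obtain d where "1 = of_nat 2 * d" by (rule dvdE)
    then have d: "of_nat 2 * d = of_nat 1" by (simp only: of_nat_1)
    have "d \<noteq> 0" using d by (intro notI) (simp only: mult_zero_right of_nat_1 zero_neq_one)
    then have "0 < d" by (simp add: zero_less_iff_neq_zero)
    from le_mult_pos[OF this, of "of_nat 2"] have "of_nat 2 \<le> of_nat 1" unfolding d .
    then show False by (simp only: of_nat_le_iff)
  qed
  then have "(\<Sum>i\<le>k. m' i * (\<Prod>j\<in>{..k} - {i}. n + j)) \<noteq> p' * (\<Prod>j\<le>k. n + j)"
    by (rule sum_cofactors_ne_multiple[OF \<open>k > 0\<close> \<open>n > 0\<close>])
  ultimately show False by contradiction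
qed

end

section \<open>First-order semantics and models of \<open>PA_minus\<close>\<close>

text \<open>\<open>holds_in\<close> already ranges over all assignments; a quantifier is stripped by
  instantiating it with the current value \<open>e x\<close>.\<close>

lemma holds_in_Alls: "holds_in M (Alls xs \<phi>) \<longleftrightarrow> holds_in M \<phi>"
  unfolding Alls_def
proof (induct xs)
  case (Cons x xs)
  have "holds_in M (All x \<psi>) \<longleftrightarrow> holds_in M \<psi>" for \<psi>
    unfolding holds_in_def by (auto, metis fun_upd_triv)
  with Cons show ?case by simp
qed simp

text \<open>Beyond translating axioms, \<open>cancel\<close> comes from trichotomy and strict
  monotonicity of addition, and \<open>le_add\<close> from nonnegativity; \<open>le_add\<close> and
  \<open>diff\<close> together give the canonical order.\<close>

lemma discrete_semiring_model:
  assumes "is_model M PA_minus"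
  shows "class.discrete_semiring (s_plus M) (s_zero M) (\<lambda>x y. s_less M x y \<or> x = y) (s_less M)
    (s_one M) (s_times M)"
proof -
  note ax = assms[unfolded is_model_def PA_minus_def Let_def holds_in_def Alls_def, simplified]
  have add_assoc: "s_plus M (s_plus M x y) z = s_plus M x (s_plus M y z)" for x y z
    using ax by metis
  have add_commute: "s_plus M x y = s_plus M y x" for x y
    using ax by metis
  have mult_assoc: "s_times M (s_times M x y) z = s_times M x (s_times M y z)" for x y z
    using ax by metis
  have mult_commute: "s_times M x y = s_times M y x" for x y
    using ax by metis
  have distrib: "s_times M x (s_plus M y z) = s_plus M (s_times M x y) (s_times M x z)" for x y z
    using ax by metis
  have zero: "s_plus M x (s_zero M) = x" "s_times M x (s_zero M) = s_zero M" for x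
    using ax by metis+
  have one: "s_times M x (s_one M) = x" for x
    using ax by metis
  have trans: "s_less M x y \<Longrightarrow> s_less M y z \<Longrightarrow> s_less M x z" for x y z
    using ax by metis
  have irrefl: "\<not> s_less M x x" for x
    using ax by metis
  have total: "s_less M x y \<or> x = y \<or> s_less M y x" for x y
    using ax by metis
  have add_less: "s_less M x y \<Longrightarrow> s_less M (s_plus M x z) (s_plus M y z)" for x y z
    using ax by metis
  have mult_less: "s_less M (s_zero M) z \<Longrightarrow> s_less M x y \<Longrightarrow> s_less M (s_times M x z) (s_times M y z)"
    for x y z
    using ax by metis
  have diff: "s_less M x y \<Longrightarrow> \<exists>z. s_plus M x z = y" for x y
    using ax by metis
  have discrete: "s_less M (s_zero M) (s_one M)"
    "s_less M (s_zero M) x \<Longrightarrow> s_less M (s_one M) x \<or> x = s_one M" for x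
    using ax by metis+
  have nonneg: "s_less M (s_zero M) x \<or> x = s_zero M" for x
    using ax by metis
  have distrib': "s_times M (s_plus M y z) x = s_plus M (s_times M y x) (s_times M z x)" for x y z
    by (metis distrib mult_commute)
  have cancel: "x = y" if "s_plus M x z = s_plus M y z" for x y z
    using that by (metis total add_less irrefl)
  have le_add: "s_less M x (s_plus M x c) \<or> x = s_plus M x c" for x c
    using add_less[of "s_zero M" c x] nonneg[of c] by (metis add_commute zero(1))
  show ?thesis
    by unfold_locales
      (metis add_assoc add_commute mult_assoc mult_commute distrib distrib' zero one trans irrefl
        total add_less mult_less diff discrete cancel le_add)+
qed

text \<open>Links the bracketed expressions of the language to \<open>sum\<close> and
  \<open>prod\<close> over sets. Lists are built from the right because the last operand of a
  left-bracketed fold is outermost.\<close>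

lemma (in comm_monoid_set) big_eq_F: "is \<noteq> [] \<Longrightarrow> distinct is \<Longrightarrow> big f is g = F g (set is)"
proof (induct "is" rule: rev_nonempty_induct)
  case (single x) then show ?case by (simp add: big_def)
next
  case (snoc x xs) then show ?case by (simp add: big_def commute)
qed

lemma sat_big_Or: "is \<noteq> [] \<Longrightarrow> sat M e (big Or is g) \<longleftrightarrow> (\<exists>i\<in>set is. sat M e (g i))"
  by (induct "is" rule: rev_nonempty_induct) (auto simp: big_def)

lemma eval_big_Plus:
  "is \<noteq> [] \<Longrightarrow> eval_tm M e (big Plus is g) = big (s_plus M) is (\<lambda>i. eval_tm M e (g i))"
  by (induct "is" rule: rev_nonempty_induct) (auto simp: big_def)

lemma eval_big_Times:
  "is \<noteq> [] \<Longrightarrow> eval_tm M e (big Times is g) = big (s_times M) is (\<lambda>i. eval_tm M e (g i))"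
  by (induct "is" rule: rev_nonempty_induct) (auto simp: big_def)

theorem mainTheorem1:
  fixes k :: nat and M :: "'a lstruct"
  assumes "k > 0" and "is_model M PA_minus"
  shows "holds_in M (phi k)"
proof -
  define le where "le x y \<longleftrightarrow> s_less M x y \<or> x = y" for x y
  interpret discrete_semiring "s_plus M" "s_zero M" le "s_less M" "s_one M" "s_times M"
    using discrete_semiring_model[OF assms(2)] unfolding le_def .
  \<comment> \<open>Numerals add 1 on the right, \<open>of_nat\<close> on the left; commutativity
    reconciles them.\<close>
  have num: "eval_tm M e (num_tm i) = of_nat i" for e i
    by (induct i rule: num_tm.induct) (simp_all add: add_commute)
  have I: "[0..<Suc k] \<noteq> []" "distinct [0..<Suc k]" "set [0..<Suc k] = {..k}"
    by auto
  have J: "filter (\<lambda>j. j \<noteq> i) [0..<Suc k] \<noteq> []" "distinct (filter (\<lambda>j. j \<noteq> i) [0..<Suc k])"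
    "set (filter (\<lambda>j. j \<noteq> i) [0..<Suc k]) = {..k} - {i}" for i
  proof -
    show "set (filter (\<lambda>j. j \<noteq> i) [0..<Suc k]) = {..k} - {i}" by auto
    \<comment> \<open>Here \<open>k > 0\<close> keeps the cofactor products nonempty: index 1
      remains when 0 is removed.\<close>
    moreover have "(if i = 0 then 1 else 0) \<in> {..k} - {i}" using assms(1) by auto
    ultimately show "filter (\<lambda>j. j \<noteq> i) [0..<Suc k] \<noteq> []" by (metis empty_iff list.set(1))
  qed simp
  show ?thesis
    unfolding phi_def Let_def holds_in_Alls
    unfolding holds_in_def
  proof
    fix e :: "nat \<Rightarrow> 'a"
    let ?N = "\<lambda>i. s_plus M (e 0) (of_nat i)"
    \<comment> \<open>Under \<open>e\<close>, variable 0 is \<open>n\<close>, 1 is \<open>p\<close>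
      and \<open>4 + i\<close> is the \<open>i\<close>-th \<open>m\<close>; \<open>local.sum\<close>
      and \<open>local.prod\<close> use the operations of \<open>M\<close>.\<close>
    have key: "(\<exists>i\<in>{..k}. \<forall>a b. s_times M (e (4 + i)) a \<noteq> s_plus M (s_times M (?N i) b) (s_one M)) \<or>
      (\<exists>i\<in>{..k}. s_less M (?N i) (e (4 + i))) \<or>
      local.sum (\<lambda>i. s_times M (e (4 + i)) (local.prod ?N ({..k} - {i}))) {..k}
        \<noteq> s_times M (e 1) (local.prod ?N {..k})"
    proof (intro disjCI)
      assume "\<not> ((\<exists>i\<in>{..k}. s_less M (?N i) (e (4 + i))) \<or>
        local.sum (\<lambda>i. s_times M (e (4 + i)) (local.prod ?N ({..k} - {i}))) {..k}
          \<noteq> s_times M (e 1) (local.prod ?N {..k}))"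
      then have eq: "local.sum (\<lambda>i. s_times M (e (4 + i)) (local.prod ?N ({..k} - {i}))) {..k}
          = s_times M (e 1) (local.prod ?N {..k})"
        and nless: "\<And>i. i \<le> k \<Longrightarrow> \<not> s_less M (?N i) (e (4 + i))"
        by auto
      show "\<exists>i\<in>{..k}. \<forall>a b. s_times M (e (4 + i)) a \<noteq> s_plus M (s_times M (?N i) b) (s_one M)"
      proof (rule ccontr)
        assume "\<not> ?thesis"
        then have "\<exists>a b. s_times M (e (4 + i)) a = s_plus M (s_times M (?N i) b) (s_one M)"
          if "i \<le> k" for i
          using that by auto
        moreover have "le (e (4 + i)) (?N i)" if "i \<le> k" for i
          using nless[OF that] by (simp only: not_less)
        ultimately have "local.sum (\<lambda>i. s_times M (e (4 + i)) (local.prod ?N ({..k} - {i}))) {..k}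
          \<noteq> s_times M (e 1) (local.prod ?N {..k})"
          by (rule sum_cofactors_ne_multiple_discrete[OF assms(1)])
        with eq show False by contradiction
      qed
    qed
    show "sat M e
      (big Or [0..<Suc k] (\<lambda>i. Alls [2, 3] (Var (4 + i) \<^bold>* Var 2 \<^bold>\<noteq> (Var 0 \<^bold>+ num_tm i) \<^bold>* Var 3 \<^bold>+ \<^bold>1)) \<^bold>\<or>
       big Or [0..<Suc k] (\<lambda>i. (Var 0 \<^bold>+ num_tm i) \<^bold>< Var (4 + i)) \<^bold>\<or>
       big Plus [0..<Suc k] (\<lambda>i. Var (4 + i)
         \<^bold>* big Times (filter (\<lambda>j. j \<noteq> i) [0..<Suc k]) (\<lambda>i. Var 0 \<^bold>+ num_tm i))
         \<^bold>\<noteq> Var 1 \<^bold>* big Times [0..<Suc k] (\<lambda>i. Var 0 \<^bold>+ num_tm i))"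
      unfolding sat.simps sat_big_Or[OF I(1)] eval_big_Plus[OF I(1)] eval_big_Times[OF I(1)]
        eval_big_Times[OF J(1)] eval_tm.simps num sum.big_eq_F[OF I(1,2)]
        prod.big_eq_F[OF I(1,2)] prod.big_eq_F[OF J(1,2)] I(3) J(3)
      using key by (simp add: Alls_def num)
  qed
qed

end
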